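(* Let $X$ be a Banach space with norm $\|\cdot\|$. Let $(I(t))_{t\ge0}$ be a family of operators $I(t)\colon X\to X$ which is BL-admissible with base point $x_0=0$ (see context), and let $(S(t))_{t\ge0}$ be a strongly continuous semigroup of (not necessarily linear) operators on $X$ such that $$\left\|\frac{S(t)x-x}{t}-y\right\|\le\sup_{n}\left\|\frac{I(\pi_n^t)x-x}{t}-y\right\|\quad\text{for all } t\in\mathcal{T}\setminus\{0\}\text{ and } x,y\in X,$$ where the supremum is over all $n\in\mathbb{N}$ with $2^nt\in\mathbb{N}$. Let $x,y\in X$ be such that for every $\varepsilon>0$ there exists $t_0>0$ with $$\left\|\frac{I(2^{-n})^k(x+2^{-n}y)-I(2^{-n})^kx}{2^{-n}}-y\right\|\le\varepsilon\quad\text{for all } k,n\in\mathbb{N}\text{ with } k2^{-n}\le t_0.$$ Then $$\lim_{t\downarrow0}\left\|\frac{I(t)x-x}{t}-y\right\|=0\quad\text{implies}\quad\lim_{t\downarrow0}\left\|\frac{S(t)x-x}{t}-y\right\|=0.$$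
   Context: $\mathbb{N}=\{1,2,\dots\}$, $\mathbb{N}_0=\mathbb{N}\cup\{0\}$, $\mathbb{R}_+=[0,\infty)$; $B(x,r)$ is the closed ball of radius $r$ around $x$. BL-admissible with base point $x_0=0$ means: (i) $I(0)=\mathrm{id}_X$; (ii) there is a function $\alpha\colon\mathbb{R}_+\times\mathbb{R}_+\to\mathbb{R}_+$, non-decreasing in the second argument, with $\alpha(\alpha(r,s),t)\le\alpha(r,s+t)$ for all $r,s,t\ge0$, such that $I(t)$ maps $B(0,r)$ into $B(0,\alpha(r,t))$ for all $r,t\ge0$; (iii) for every $r\ge0$ there is $\omega_r\ge0$ with $\|I(t)x-I(t)y\|\le e^{t\omega_r}\|x-y\|$ for all $t\in[0,1]$ and $x,y\in B(0,r)$. $\mathcal{T}:=\{k2^{-n}:k,n\in\mathbb{N}_0\}$, and for $t\in\mathcal{T}$, $n\in\mathbb{N}$ with $2^nt\in\mathbb{N}_0$, $I(\pi_n^t):=I(2^{-n})^{2^nt}$ (iterated composition). $(S(t))_{t\ge0}$ is a strongly continuous semigroup on $X$ if $S(t)\colon X\to X$, $S(0)=\mathrm{id}_X$, $S(s+t)=S(s)S(t)$ for all $s,t\ge0$, and $t\mapsto S(t)x$ is continuous on $\mathbb{R}_+$ for every $x\in X$. *)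

theory Defs
  imports "HOL-Analysis.Analysis"
begin

text \<open>
  Families indexed by \<open>t \<ge> 0\<close> are rendered as functions on \<^typ>\<open>real\<close>; every condition below
  is restricted to nonnegative times, so the values at negative times are irrelevant.
\<close>

text \<open>BL-admissibility, with the base point fixed to be the origin.\<close>

definition bl_admissible :: "(real \<Rightarrow> 'a::real_normed_vector \<Rightarrow> 'a) \<Rightarrow> bool" where
  "bl_admissible I \<longleftrightarrow>
     I 0 = id \<and>
     (\<exists>\<alpha> :: real \<Rightarrow> real \<Rightarrow> real.
        (\<forall>r\<ge>0. \<forall>t\<ge>0. 0 \<le> \<alpha> r t) \<and>
        (\<forall>r\<ge>0. mono_on {0..} (\<alpha> r)) \<and>
        (\<forall>r\<ge>0. \<forall>s\<ge>0. \<forall>t\<ge>0. \<alpha> (\<alpha> r s) t \<le> \<alpha> r (s + t)) \<and>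
        (\<forall>r\<ge>0. \<forall>t\<ge>0. I t ` cball 0 r \<subseteq> cball 0 (\<alpha> r t))) \<and>
     (\<forall>r\<ge>0. \<exists>\<omega>\<ge>0. \<forall>t\<in>{0..1}. \<forall>x\<in>cball 0 r. \<forall>y\<in>cball 0 r.
        norm (I t x - I t y) \<le> exp (t * \<omega>) * norm (x - y))"

definition strongly_continuous_semigroup ::
    "(real \<Rightarrow> 'a::real_normed_vector \<Rightarrow> 'a) \<Rightarrow> bool" where
  "strongly_continuous_semigroup S \<longleftrightarrow>
     S 0 = id \<and>
     (\<forall>s\<ge>0. \<forall>t\<ge>0. S (s + t) = S s \<circ> S t) \<and>
     (\<forall>x. continuous_on {0..} (\<lambda>t. S t x))"

text \<open>
  The iterate $I(\pi_n^t) = I(2^{-n})^{2^n t}$. It is only meaningful when \<open>2 ^ n * t\<close> is a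
  natural number, in which case the floor is exact.
\<close>

definition dyadic_iterate :: "(real \<Rightarrow> 'a \<Rightarrow> 'a) \<Rightarrow> nat \<Rightarrow> real \<Rightarrow> 'a \<Rightarrow> 'a" where
  "dyadic_iterate I n t = I (1 / 2 ^ n) ^^ nat \<lfloor>2 ^ n * t\<rfloor>"

end

theory Submission
  imports Defs
begin

text \<open>
  The argument combines consistency (small one-step errors) with stability (Lipschitz bounds for
  the iterates), as for numerical one-step schemes. Write \<open>h = 1 / 2 ^ n\<close>,
  \<open>F = I h\<close> and let \<open>t = K h\<close> be dyadic. The total increment of the iterates telescopes,
  \<open>F\<^sup>K x - x - t y = (\<Sum>k<K. F\<^sup>k (F x) - F\<^sup>k x - h y)\<close>, and inserting \<open>F\<^sup>k (x + h y)\<close> splits each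
  summand into two errors. The first, \<open>F\<^sup>k (F x) - F\<^sup>k (x + h y)\<close>, is, for \<open>t \<le> 1\<close>, at most
  \<open>exp \<omega>\<close> times the one-step error \<open>F x - x - h y\<close>, because the iterates of an admissible family
  are Lipschitz on bounded sets uniformly up to time 1 (\<open>bl_admissible_iterates_lipschitz\<close>); the
  one-step error is \<open>o(h)\<close> when \<open>I\<close> is differentiable at \<open>x\<close> with derivative \<open>y\<close>. The second,
  \<open>F\<^sup>k (x + h y) - F\<^sup>k x - h y\<close>, is at most \<open>\<epsilon> h\<close> by the last hypothesis once \<open>t\<close>
  is small, for all \<open>k\<close> and \<open>n\<close> alike.
  Summing the \<open>K\<close> errors and dividing by \<open>t = K h\<close> leaves a quantity that is small as soon as \<open>t\<close>
  is, uniformly in \<open>n\<close>, since \<open>h \<le> t\<close> (\<open>iterate_quotient_tendsto\<close>).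

  Uniformity in \<open>n\<close> lets the estimate pass to the supremum that dominates the difference quotient
  of \<open>S\<close>, which is thus controlled at small dyadic times; density of the dyadics and continuity of
  \<open>t \<mapsto> S t x\<close> extend the control to all small times (\<open>bound_from_dyadics\<close>).
\<close>

text \<open>
  Composing with one more step of length \<open>h\<close> turns \<open>\<alpha> r s\<close> into \<open>\<alpha> (\<alpha> r s) h\<close>, which
  the hypothesis on \<open>\<alpha>\<close> bounds by the same function at the total elapsed time. The iteration
  starts at one step rather than at zero, because nothing here relates \<open>r\<close> to \<open>\<alpha> r 0\<close>.
\<close>
lemma funpow_mem_cball_growth:
  fixes I :: "real \<Rightarrow> 'a::real_normed_vector \<Rightarrow> 'a" and \<alpha> :: "real \<Rightarrow> real \<Rightarrow> real"
  assumes nonneg: "\<And>r t. 0 \<le> r \<Longrightarrow> 0 \<le> t \<Longrightarrow> 0 \<le> \<alpha> r t"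
    and comp: "\<And>r s t. 0 \<le> r \<Longrightarrow> 0 \<le> s \<Longrightarrow> 0 \<le> t \<Longrightarrow> \<alpha> (\<alpha> r s) t \<le> \<alpha> r (s + t)"
    and maps: "\<And>r t u. 0 \<le> r \<Longrightarrow> 0 \<le> t \<Longrightarrow> norm u \<le> r \<Longrightarrow> norm (I t u) \<le> \<alpha> r t"
    and "0 \<le> h" "0 \<le> r" "norm u \<le> r"
  shows "norm ((I h ^^ Suc k) u) \<le> \<alpha> r (real (Suc k) * h)"
proof (induction k)
  case 0
  show ?case using maps[of r h u] assms by simp
next
  case (Suc k)
  have "norm (I h ((I h ^^ Suc k) u)) \<le> \<alpha> (\<alpha> r (real (Suc k) * h)) h"
    using Suc.IH nonneg[of r "real (Suc k) * h"] \<open>0 \<le> h\<close> \<open>0 \<le> r\<close> by (intro maps) auto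
  also have "\<dots> \<le> \<alpha> r (real (Suc k) * h + h)"
    using \<open>0 \<le> h\<close> \<open>0 \<le> r\<close> by (intro comp) auto
  finally show ?case by (simp add: algebra_simps)
qed

text \<open>
  Up to total time 1 all iterates started in a ball stay in one fixed larger ball, so a single
  Lipschitz rate serves for every step, and the factors \<open>exp (h * \<omega>)\<close> multiply up.
\<close>
lemma bl_admissible_iterates_lipschitz:
  fixes I :: "real \<Rightarrow> 'a::real_normed_vector \<Rightarrow> 'a"
  assumes "bl_admissible I" and "0 \<le> r"
  obtains \<omega> where "0 \<le> \<omega>"
    and "\<And>h k u v. 0 \<le> h \<Longrightarrow> h \<le> 1 \<Longrightarrow> real k * h \<le> 1 \<Longrightarrow> norm u \<le> r \<Longrightarrow> norm v \<le> r \<Longrightarrow>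
           norm ((I h ^^ k) u - (I h ^^ k) v) \<le> exp (real k * h * \<omega>) * norm (u - v)"
proof -
  from assms(1) obtain \<alpha> :: "real \<Rightarrow> real \<Rightarrow> real" where
      nonneg: "\<forall>r\<ge>0. \<forall>t\<ge>0. 0 \<le> \<alpha> r t"
    and mono: "\<forall>r\<ge>0. mono_on {0..} (\<alpha> r)"
    and comp: "\<forall>r\<ge>0. \<forall>s\<ge>0. \<forall>t\<ge>0. \<alpha> (\<alpha> r s) t \<le> \<alpha> r (s + t)"
    and ball: "\<forall>r\<ge>0. \<forall>t\<ge>0. I t ` cball 0 r \<subseteq> cball 0 (\<alpha> r t)"
    unfolding bl_admissible_def by (elim conjE exE)
  have maps: "norm (I t u) \<le> \<alpha> r t" if "0 \<le> r" "0 \<le> t" "norm u \<le> r" for r t u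
    using subsetD[OF ball[rule_format, OF that(1,2)], of "I t u"] that(3) by simp
  define R where "R = max r (\<alpha> r 1)"
  have "0 \<le> R" using \<open>0 \<le> r\<close> by (simp add: R_def)
  with assms(1) have "\<exists>\<omega>\<ge>0. \<forall>t\<in>{0..1}. \<forall>u\<in>cball 0 R. \<forall>v\<in>cball 0 R.
      norm (I t u - I t v) \<le> exp (t * \<omega>) * norm (u - v)"
    by (simp only: bl_admissible_def)
  then obtain \<omega> where "0 \<le> \<omega>"
    and lip: "\<And>t u v. 0 \<le> t \<Longrightarrow> t \<le> 1 \<Longrightarrow> norm u \<le> R \<Longrightarrow> norm v \<le> R \<Longrightarrow>
                norm (I t u - I t v) \<le> exp (t * \<omega>) * norm (u - v)"
    by auto
  have stay: "norm ((I h ^^ k) u) \<le> R" if "0 \<le> h" "real k * h \<le> 1" "norm u \<le> r" for h k u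
  proof (cases k)
    case 0
    then show ?thesis using that by (simp add: R_def)
  next
    case (Suc j)
    have "norm ((I h ^^ k) u) \<le> \<alpha> r (real k * h)"
      unfolding Suc
      by (rule funpow_mem_cball_growth[OF nonneg[rule_format] comp[rule_format] maps that(1) \<open>0 \<le> r\<close> that(3)])
    also have "\<dots> \<le> \<alpha> r 1"
      using that by (intro mono_onD[OF mono[rule_format, OF \<open>0 \<le> r\<close>]]) auto
    finally show ?thesis by (simp add: R_def)
  qed
  have "norm ((I h ^^ k) u - (I h ^^ k) v) \<le> exp (real k * h * \<omega>) * norm (u - v)"
    if "0 \<le> h" "h \<le> 1" "real k * h \<le> 1" "norm u \<le> r" "norm v \<le> r" for h k u v
    using that(3)
  proof (induction k)
    case 0
    show ?case by simp
  next
    case (Suc k)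
    have kh: "real k * h \<le> 1" using Suc.prems \<open>0 \<le> h\<close> by (simp add: algebra_simps)
    have "norm ((I h ^^ Suc k) u - (I h ^^ Suc k) v)
            \<le> exp (h * \<omega>) * norm ((I h ^^ k) u - (I h ^^ k) v)"
      using lip[OF that(1,2) stay[OF that(1) kh that(4)] stay[OF that(1) kh that(5)]] by simp
    also have "\<dots> \<le> exp (h * \<omega>) * (exp (real k * h * \<omega>) * norm (u - v))"
      using Suc.IH[OF kh] by simp
    also have "\<dots> = exp (real (Suc k) * h * \<omega>) * norm (u - v)"
      by (simp add: algebra_simps flip: exp_add)
    finally show ?case .
  qed
  with \<open>0 \<le> \<omega>\<close> show ?thesis by (rule that)
qed

text \<open>
  Telescoping: each step contributes the propagated one-step error and the defect of \<open>F\<^sup>k\<close> from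
  translating by \<open>d\<close>.
\<close>
lemma norm_funpow_increment_le:
  fixes F :: "'a::real_normed_vector \<Rightarrow> 'a"
  assumes "\<And>k. k < K \<Longrightarrow> norm ((F ^^ k) (F x) - (F ^^ k) (x + d)) \<le> a"
    and "\<And>k. k < K \<Longrightarrow> norm ((F ^^ k) (x + d) - (F ^^ k) x - d) \<le> b"
  shows "norm ((F ^^ K) x - x - real K *\<^sub>R d) \<le> real K * (a + b)"
  using assms
proof (induction K)
  case 0
  show ?case by simp
next
  case (Suc K)
  have "(F ^^ Suc K) x - x - real (Suc K) *\<^sub>R d
      = ((F ^^ K) x - x - real K *\<^sub>R d)
        + (((F ^^ K) (F x) - (F ^^ K) (x + d)) + ((F ^^ K) (x + d) - (F ^^ K) x - d))"
    by (simp add: algebra_simps funpow_swap1)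
  also have "norm \<dots> \<le> real K * (a + b) + (a + b)"
    using Suc by (intro norm_triangle_mono) auto
  finally show ?case by (simp add: algebra_simps)
qed

lemma norm_quotient_le_iff:
  fixes z y :: "'a::real_normed_vector"
  assumes "0 < t"
  shows "norm (z /\<^sub>R t - y) \<le> e \<longleftrightarrow> norm (z - t *\<^sub>R y) \<le> e * t"
proof -
  have "z /\<^sub>R t - y = (z - t *\<^sub>R y) /\<^sub>R t"
    using assms by (simp add: scaleR_diff_right)
  then have "norm (z /\<^sub>R t - y) = norm (z - t *\<^sub>R y) / t"
    using assms by (simp add: divide_inverse)
  then show ?thesis using assms by (simp add: pos_divide_le_eq)
qed

text \<open>
  As \<open>K \<ge> 1\<close>, a short elapsed time forces a short step, so one threshold \<open>T\<close> for the elapsed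
  time serves all \<open>n\<close> at once; passing to a supremum over \<open>n\<close> needs this uniformity.
\<close>
lemma iterate_quotient_tendsto:
  fixes I :: "real \<Rightarrow> 'a::real_normed_vector \<Rightarrow> 'a" and x y :: 'a
  assumes adm: "bl_admissible I"
    and transl: "\<And>e. 0 < e \<Longrightarrow> \<exists>t\<^sub>0>0. \<forall>k n :: nat. 1 \<le> k \<longrightarrow> 1 \<le> n \<longrightarrow> real k * (1 / 2 ^ n) \<le> t\<^sub>0 \<longrightarrow>
           norm (((I (1 / 2 ^ n) ^^ k) (x + (1 / 2 ^ n) *\<^sub>R y) - (I (1 / 2 ^ n) ^^ k) x)
                   /\<^sub>R (1 / 2 ^ n) - y) \<le> e"
    and deriv: "((\<lambda>t. norm ((I t x - x) /\<^sub>R t - y)) \<longlongrightarrow> 0) (at_right 0)"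
    and "0 < e"
  obtains T where "0 < T"
    and "\<And>K n :: nat. 1 \<le> K \<Longrightarrow> 1 \<le> n \<Longrightarrow> real K * (1 / 2 ^ n) \<le> T \<Longrightarrow>
           norm (((I (1 / 2 ^ n) ^^ K) x - x) /\<^sub>R (real K * (1 / 2 ^ n)) - y) \<le> e"
proof -
  \<comment> \<open>All points \<open>x + h *\<^sub>R y\<close> and, since differentiability gives \<open>norm (I h x - x - h *\<^sub>R y) \<le> h\<close>
      for small \<open>h\<close>, all points \<open>I h x\<close> lie in a ball of this radius.\<close>
  define r where "r = norm x + norm y + 1"
  have "0 \<le> r" by (simp add: r_def)
  obtain \<omega> where "0 \<le> \<omega>"
    and lip: "\<And>h k u v. 0 \<le> h \<Longrightarrow> h \<le> 1 \<Longrightarrow> real k * h \<le> 1 \<Longrightarrow> norm u \<le> r \<Longrightarrow> norm v \<le> r \<Longrightarrow>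
           norm ((I h ^^ k) u - (I h ^^ k) v) \<le> exp (real k * h * \<omega>) * norm (u - v)"
    by (rule bl_admissible_iterates_lipschitz[OF adm \<open>0 \<le> r\<close>]) blast
  \<comment> \<open>Propagation up to time 1 costs at most a factor \<open>exp \<omega>\<close>.\<close>
  define \<delta> where "\<delta> = min 1 (e / 2 / exp \<omega>)"
  have "0 < \<delta>" "\<delta> \<le> 1" using \<open>0 < e\<close> by (simp_all add: \<delta>_def)
  have "exp \<omega> * \<delta> \<le> exp \<omega> * (e / 2 / exp \<omega>)"
    unfolding \<delta>_def by (intro mult_left_mono) auto
  then have exp_\<delta>: "exp \<omega> * \<delta> \<le> e / 2" by simp
  have "\<forall>\<^sub>F t in at_right 0. norm ((I t x - x) /\<^sub>R t - y) < \<delta>"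
    using order_tendstoD(2)[OF deriv \<open>0 < \<delta>\<close>] .
  then obtain b where "0 < b"
    and b: "\<And>t. 0 < t \<Longrightarrow> t < b \<Longrightarrow> norm ((I t x - x) /\<^sub>R t - y) < \<delta>"
    unfolding eventually_at_right_field by auto
  obtain c where "0 < c"
    and c: "\<And>k n :: nat. 1 \<le> k \<Longrightarrow> 1 \<le> n \<Longrightarrow> real k * (1 / 2 ^ n) \<le> c \<Longrightarrow>
           norm (((I (1 / 2 ^ n) ^^ k) (x + (1 / 2 ^ n) *\<^sub>R y) - (I (1 / 2 ^ n) ^^ k) x)
                   /\<^sub>R (1 / 2 ^ n) - y) \<le> e / 2"
    using transl[of "e / 2"] \<open>0 < e\<close> by auto
  show ?thesis
  proof
    show "0 < min 1 (min (b / 2) c)" using \<open>0 < b\<close> \<open>0 < c\<close> by simp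
  next
    fix K n :: nat
    assume K: "1 \<le> K" and n: "1 \<le> n" and T: "real K * (1 / 2 ^ n) \<le> min 1 (min (b / 2) c)"
    define h :: real where "h = 1 / 2 ^ n"
    have "0 < h" by (simp add: h_def)
    have h_le: "h \<le> real K * h" using K \<open>0 < h\<close> by simp
    have Kh: "real K * h \<le> 1" "real K * h \<le> b / 2" "real K * h \<le> c"
      using T by (simp_all add: h_def)
    then have "h \<le> 1" "h < b" using h_le \<open>0 < b\<close> by linarith+
    have kh: "real k * h \<le> real K * h" if "k < K" for k
      using that \<open>0 < h\<close> by simp
    have step: "norm (I h x - (x + h *\<^sub>R y)) \<le> \<delta> * h"
      using b[OF \<open>0 < h\<close> \<open>h < b\<close>] norm_quotient_le_iff[OF \<open>0 < h\<close>, of "I h x - x" y \<delta>]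
      by (simp add: diff_diff_eq)
    have hy: "norm (h *\<^sub>R y) \<le> norm y"
      using \<open>0 < h\<close> \<open>h \<le> 1\<close> by (simp add: mult_left_le_one_le)
    have xhy: "norm (x + h *\<^sub>R y) \<le> norm x + norm y"
      using norm_triangle_ineq[of x "h *\<^sub>R y"] hy by linarith
    have "\<delta> * h \<le> 1" using \<open>\<delta> \<le> 1\<close> \<open>h \<le> 1\<close> \<open>0 < \<delta>\<close> \<open>0 < h\<close> by (simp add: mult_le_one)
    then have Ihx: "norm (I h x) \<le> r"
      using norm_triangle_sub[of "I h x" "x + h *\<^sub>R y"] step xhy unfolding r_def by linarith
    have "norm ((I h ^^ K) x - x - real K *\<^sub>R (h *\<^sub>R y)) \<le> real K * (e / 2 * h + e / 2 * h)"
    proof (rule norm_funpow_increment_le)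
      fix k assume "k < K"
      have "real k * h \<le> 1" using kh[OF \<open>k < K\<close>] Kh(1) by linarith
      then have "norm ((I h ^^ k) (I h x) - (I h ^^ k) (x + h *\<^sub>R y))
              \<le> exp (real k * h * \<omega>) * norm (I h x - (x + h *\<^sub>R y))"
        using \<open>0 < h\<close> \<open>h \<le> 1\<close> Ihx xhy by (intro lip) (auto simp: r_def)
      also have "\<dots> \<le> exp \<omega> * (\<delta> * h)"
        using step \<open>real k * h \<le> 1\<close> \<open>0 \<le> \<omega>\<close> \<open>0 < h\<close>
        by (intro mult_mono) (auto simp: mult_left_le_one_le)
      also have "\<dots> \<le> e / 2 * h"
        using mult_right_mono[OF exp_\<delta>, of h] \<open>0 < h\<close> by (simp add: mult.assoc)
      finally show "norm ((I h ^^ k) (I h x) - (I h ^^ k) (x + h *\<^sub>R y)) \<le> e / 2 * h" .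
      show "norm ((I h ^^ k) (x + h *\<^sub>R y) - (I h ^^ k) x - h *\<^sub>R y) \<le> e / 2 * h"
      proof (cases "k = 0")
        case True
        then show ?thesis using \<open>0 < h\<close> \<open>0 < e\<close> by simp
      next
        case False
        then have "norm (((I h ^^ k) (x + h *\<^sub>R y) - (I h ^^ k) x) /\<^sub>R h - y) \<le> e / 2"
          using c[of k n] n kh[OF \<open>k < K\<close>] Kh(3) unfolding h_def by linarith
        then show ?thesis by (simp only: norm_quotient_le_iff[OF \<open>0 < h\<close>])
      qed
    qed
    then have "norm ((I h ^^ K) x - x - (real K * h) *\<^sub>R y) \<le> e * (real K * h)"
      by (simp add: algebra_simps)
    then have "norm (((I h ^^ K) x - x) /\<^sub>R (real K * h) - y) \<le> e"
      using K \<open>0 < h\<close> by (subst norm_quotient_le_iff) auto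
    then show "norm (((I (1 / 2 ^ n) ^^ K) x - x) /\<^sub>R (real K * (1 / 2 ^ n)) - y) \<le> e"
      by (simp only: h_def)
  qed
qed

text \<open>
  A bound that fails at one point fails, by continuity, on a whole neighbourhood of it, and this
  contains a dyadic number.
\<close>
lemma bound_from_dyadics:
  fixes f :: "real \<Rightarrow> real"
  assumes cont: "continuous_on {0<..<T} f"
    and bound: "\<And>t. t \<in> dyadics \<Longrightarrow> 0 < t \<Longrightarrow> t < T \<Longrightarrow> f t \<le> e"
    and t: "0 < t" "t < T"
  shows "f t \<le> e"
proof (rule ccontr)
  assume "\<not> f t \<le> e"
  define U where "U = {0<..<T} \<inter> f -` {e<..}"
  have "open U"
    unfolding U_def using cont by (intro continuous_open_preimage) auto
  moreover have "t \<in> U" using t \<open>\<not> f t \<le> e\<close> by (simp add: U_def)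
  moreover have "closure ({0<..<T} \<inter> dyadics) = closure {0<..<T}"
    unfolding dyadics_def using t
    by (intro closure_dyadic_rationals_in_convex_set_pos_1) auto
  then have "t \<in> closure ({0<..<T} \<inter> dyadics)"
    using t closure_subset[of "{0<..<T}"] by auto
  ultimately have "U \<inter> ({0<..<T} \<inter> dyadics) \<noteq> {}"
    using open_Int_closure_eq_empty by blast
  then show False using bound by (force simp: U_def)
qed

theorem theorem4p3:
  fixes I S :: "real \<Rightarrow> 'a::banach \<Rightarrow> 'a" and x y :: 'a
  assumes "bl_admissible I"
    and "strongly_continuous_semigroup S"
    and "\<forall>t\<in>(dyadics :: real set) - {0}. \<forall>u v :: 'a.
           ereal (norm ((S t u - u) /\<^sub>R t - v))
             \<le> (SUP n\<in>{n::nat. 1 \<le> n \<and> 2 ^ n * t \<in> \<nat>}.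
                  ereal (norm ((dyadic_iterate I n t u - u) /\<^sub>R t - v)))"
    and "\<forall>\<epsilon>>0. \<exists>t\<^sub>0>0. \<forall>k n :: nat. 1 \<le> k \<longrightarrow> 1 \<le> n \<longrightarrow> real k * (1 / 2 ^ n) \<le> t\<^sub>0 \<longrightarrow>
           norm (((I (1 / 2 ^ n) ^^ k) (x + (1 / 2 ^ n) *\<^sub>R y) - (I (1 / 2 ^ n) ^^ k) x)
                   /\<^sub>R (1 / 2 ^ n) - y) \<le> \<epsilon>"
  shows "((\<lambda>t. norm ((I t x - x) /\<^sub>R t - y)) \<longlongrightarrow> 0) (at_right 0) \<longrightarrow>
         ((\<lambda>t. norm ((S t x - x) /\<^sub>R t - y)) \<longlongrightarrow> 0) (at_right 0)"
proof
  assume deriv: "((\<lambda>t. norm ((I t x - x) /\<^sub>R t - y)) \<longlongrightarrow> 0) (at_right 0)"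
  have cont: "continuous_on {0..} (\<lambda>t. S t x)"
    using assms(2) by (simp add: strongly_continuous_semigroup_def)
  show "((\<lambda>t. norm ((S t x - x) /\<^sub>R t - y)) \<longlongrightarrow> 0) (at_right 0)"
  proof (rule tendstoI)
    fix e :: real
    assume "0 < e"
    obtain T where "0 < T"
      and T: "\<And>K n :: nat. 1 \<le> K \<Longrightarrow> 1 \<le> n \<Longrightarrow> real K * (1 / 2 ^ n) \<le> T \<Longrightarrow>
           norm (((I (1 / 2 ^ n) ^^ K) x - x) /\<^sub>R (real K * (1 / 2 ^ n)) - y) \<le> e / 2"
      using iterate_quotient_tendsto[OF assms(1) _ deriv, of "e / 2"] assms(4) \<open>0 < e\<close>
      by (metis half_gt_zero)
    have dyadic: "norm ((S t x - x) /\<^sub>R t - y) \<le> e / 2"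
      if t: "t \<in> dyadics" "0 < t" "t < T" for t
    proof -
      have "norm ((dyadic_iterate I n t x - x) /\<^sub>R t - y) \<le> e / 2"
        if n: "1 \<le> n" and "2 ^ n * t \<in> \<nat>" for n
      proof -
        obtain K where K: "2 ^ n * t = real K" using \<open>2 ^ n * t \<in> \<nat>\<close> by (auto elim: Nats_cases)
        then have t_eq: "t = real K * (1 / 2 ^ n)" by (simp add: field_simps)
        then have "1 \<le> K" using \<open>0 < t\<close> by (cases K) auto
        moreover have "dyadic_iterate I n t = I (1 / 2 ^ n) ^^ K"
          by (simp add: dyadic_iterate_def K)
        ultimately show ?thesis using T[of K n] n \<open>t < T\<close> t_eq by simp
      qed
      then have "(SUP n\<in>{n::nat. 1 \<le> n \<and> 2 ^ n * t \<in> \<nat>}.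
                  ereal (norm ((dyadic_iterate I n t x - x) /\<^sub>R t - y))) \<le> ereal (e / 2)"
        by (intro SUP_least) simp
      moreover have "ereal (norm ((S t x - x) /\<^sub>R t - y))
          \<le> (SUP n\<in>{n::nat. 1 \<le> n \<and> 2 ^ n * t \<in> \<nat>}.
                  ereal (norm ((dyadic_iterate I n t x - x) /\<^sub>R t - y)))"
        using assms(3) t by blast
      ultimately have "ereal (norm ((S t x - x) /\<^sub>R t - y)) \<le> ereal (e / 2)"
        by (rule order_trans[rotated])
      then show ?thesis by simp
    qed
    have cont_T: "continuous_on {0<..<T} (\<lambda>t. norm ((S t x - x) /\<^sub>R t - y))"
      by (intro continuous_intros continuous_on_subset[OF cont]) auto
    have near: "norm ((S t x - x) /\<^sub>R t - y) \<le> e / 2" if "0 < t" "t < T" for t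
      by (rule bound_from_dyadics[OF cont_T _ that]) (rule dyadic)
    have e_half: "e / 2 < e" using \<open>0 < e\<close> by simp
    have "norm ((S t x - x) /\<^sub>R t - y) < e" if "0 < t" "t < T" for t
      by (rule le_less_trans[OF near[OF that] e_half])
    then show "\<forall>\<^sub>F t in at_right 0. dist (norm ((S t x - x) /\<^sub>R t - y)) 0 < e"
      using \<open>0 < T\<close> by (auto simp: eventually_at_right_field)
  qed
qed

end
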